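(* Let $D$ be a digraph with vertex set $\{v_1,\dots,v_n\}$, and let $ED$ be the extended digraph obtained by replacing each $v_i$ by an independent set $I_i$ of size $s_i\ge 1$, where every $s_i$ is odd. Then $\chi'_{\mathrm{wo}}(ED)=\chi'_{\mathrm{wo}}(D)$.
   Context: All digraphs are finite, without loops or parallel arcs (a pair of opposite arcs $uv, vu$ is allowed). Given $D$ with vertices $v_1,\dots,v_n$ and positive integers $s_1,\dots,s_n$, the extended digraph $ED$ has vertex set $I_1\cup\dots\cup I_n$ (disjoint sets, $|I_i|=s_i$, each $I_i$ independent), and for $x\in I_i$, $y\in I_j$ there is an arc $xy$ iff $v_iv_j\in A(D)$. For a vertex $v$, the semi-cuts of $v$ are $\partial^+(v)$ (arcs leaving $v$) and $\partial^-(v)$ (arcs entering $v$). A map $\varphi:A(D)\to[k]=\{1,\dots,k\}$ satisfies condition (WO) at $v$ if there is a color $i\in[k]$ such that every nonempty semi-cut of $v$ contains an odd number of arcs of color $i$ (vacuous if both semi-cuts are empty). A weak-odd $k$-edge coloring is such a map satisfying (WO) at every vertex, and the weak-odd chromatic index $\chi'_{\mathrm{wo}}(D)$ is the least $k\ge0$ for which one exists. *)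

theory Defs
  imports "Graph_Theory.Digraph" "HOL-Library.Disjoint_Sets"
begin

text \<open>
  The locale \<open>digraph\<close> describes finite digraphs without loops and parallel arcs
  (opposite arcs are allowed); the semi-cuts of a vertex \<open>v\<close> are \<open>out_arcs D v\<close> and
  \<open>in_arcs D v\<close>.
\<close>

definition semi_cuts :: "('a, 'b) pre_digraph \<Rightarrow> 'a \<Rightarrow> 'b set set" where
  "semi_cuts D v = {out_arcs D v, in_arcs D v}"

text \<open>
  The first disjunct matters only for \<open>k = 0\<close>: it makes the condition vacuous at an isolated
  vertex although there is no color to choose.
\<close>

definition WO_at :: "('a, 'b) pre_digraph \<Rightarrow> nat \<Rightarrow> ('b \<Rightarrow> nat) \<Rightarrow> 'a \<Rightarrow> bool" where
  "WO_at D k \<phi> v \<longleftrightarrow>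
     (\<forall>S \<in> semi_cuts D v. S = {}) \<or>
     (\<exists>i \<in> {1..k}. \<forall>S \<in> semi_cuts D v. S \<noteq> {} \<longrightarrow> odd (card {e \<in> S. \<phi> e = i}))"

definition weak_odd_edge_coloring :: "('a, 'b) pre_digraph \<Rightarrow> nat \<Rightarrow> ('b \<Rightarrow> nat) \<Rightarrow> bool" where
  "weak_odd_edge_coloring D k \<phi> \<longleftrightarrow>
     \<phi> ` arcs D \<subseteq> {1..k} \<and> (\<forall>v \<in> verts D. WO_at D k \<phi> v)"

definition weak_odd_chromatic_index :: "('a, 'b) pre_digraph \<Rightarrow> nat" where
  "weak_odd_chromatic_index D = (LEAST k. \<exists>\<phi>. weak_odd_edge_coloring D k \<phi>)"

text \<open>
  \<open>ED\<close> arises from \<open>D\<close> by replacing each vertex \<open>v\<close> by the independent set \<open>I v\<close> of size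
  \<open>s v\<close>. This is a predicate rather than a construction, so that no particular choice of the
  disjoint sets \<open>I v\<close> is imposed.
\<close>

definition extended_digraph ::
  "('a, 'b) pre_digraph \<Rightarrow> ('a \<Rightarrow> nat) \<Rightarrow> ('a \<Rightarrow> 'c set) \<Rightarrow> ('c, 'd) pre_digraph \<Rightarrow> bool" where
  "extended_digraph D s I ED \<longleftrightarrow>
     digraph ED \<and>
     verts ED = (\<Union>v \<in> verts D. I v) \<and>
     disjoint_family_on I (verts D) \<and>
     (\<forall>v \<in> verts D. s v \<ge> 1 \<and> finite (I v) \<and> card (I v) = s v) \<and>
     (\<forall>v \<in> verts D. \<forall>x \<in> I v. \<forall>y \<in> I v. \<not> x \<rightarrow>\<^bsub>ED\<^esub> y) \<and>
     (\<forall>u \<in> verts D. \<forall>v \<in> verts D. \<forall>x \<in> I u. \<forall>y \<in> I v. x \<rightarrow>\<^bsub>ED\<^esub> y \<longleftrightarrow> u \<rightarrow>\<^bsub>D\<^esub> v)"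

lemma extended_digraph_exists:
  fixes D :: "('a, 'b) pre_digraph"
  assumes "digraph D" and "\<And>v. v \<in> verts D \<Longrightarrow> s v \<ge> 1"
  shows "\<exists>I (ED :: ('a \<times> nat, ('a \<times> nat) \<times> ('a \<times> nat)) pre_digraph). extended_digraph D s I ED"
proof -
  interpret digraph D by fact
  define V where "V = (SIGMA v : verts D. {..<s v})"
  define ED :: "('a \<times> nat, ('a \<times> nat) \<times> ('a \<times> nat)) pre_digraph" where
    "ED = \<lparr>verts = V, arcs = {(x, y) \<in> V \<times> V. fst x \<rightarrow>\<^bsub>D\<^esub> fst y}, tail = fst, head = snd\<rparr>"
  have fin: "finite V"
    by (simp add: V_def)
  have dom: "x \<rightarrow>\<^bsub>ED\<^esub> y \<longleftrightarrow> x \<in> V \<and> y \<in> V \<and> fst x \<rightarrow>\<^bsub>D\<^esub> fst y" for x y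
    by (auto simp: arcs_ends_conv ED_def image_iff)
  have "digraph ED"
  proof
    have "arcs ED \<subseteq> V \<times> V" by (auto simp: ED_def)
    then show "finite (arcs ED)" by (rule finite_subset) (simp add: fin)
  qed (auto simp: ED_def fin arc_to_ends_def dest: adj_not_same)
  then have "extended_digraph D s (\<lambda>v. {v} \<times> {..<s v}) ED"
    using assms(2)
    by (auto simp: extended_digraph_def dom disjoint_family_on_def V_def dest: adj_not_same)
       (auto simp: ED_def V_def)
  then show ?thesis by blast
qed

end

theory Submission
  imports Defs
begin

text \<open>
  We show that \<open>D\<close> and \<open>ED\<close> admit weak-odd colorings with the same numbers \<open>k\<close> of colors. A
  coloring of \<open>D\<close> pulls back along the projection of arcs from \<open>ED\<close> to \<open>D\<close>, because all fibres
  are odd. Conversely, if \<open>k \<le> 2\<close>, give an arc of \<open>D\<close> the color that occurs an odd number of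
  times in its fibre; as the fibre is odd, there is exactly one such color. The number of arcs of
  color \<open>i\<close> in a semi-cut of \<open>v\<close> then has the same parity as the sum of the corresponding numbers
  over the copies of \<open>v\<close>, whose number is odd.

  If \<open>k \<ge> 3\<close>, nothing has to be transported, since every digraph has a weak-odd 3-edge coloring.
  To see this, exhaust the vertices by ears: an ear is a directed cycle, or a maximal directed path,
  among the vertices not used so far. All vertices and arcs of an ear get one color. The ends of a
  path have further neighbors only among the old vertices; if there are any, one arc at each end is
  added to the ear, and the color of the ear is chosen different from those of the at most two old
  vertices reached. Every other arc avoids the colors of both of its ends. So each nonempty
  semi-cut of \<open>v\<close> contains exactly one arc of the color of \<open>v\<close>.
\<close>

section \<open>Cycles and ears in finite relations\<close>

text \<open>Passing from \<open>X\<close> to its image under \<open>f\<close> preserves closedness;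
  by finiteness this stops at a set mapped onto itself, where surjectivity forces
  injectivity.\<close>

lemma permutation_of_closed_set:
  assumes "finite X" "X \<noteq> {}" "f ` X \<subseteq> X"
  shows "\<exists>Y \<subseteq> X. Y \<noteq> {} \<and> bij_betw f Y Y"
  using assms
proof (induction X rule: finite_psubset_induct)
  case (psubset X)
  show ?case
  proof (cases "f ` X = X")
    case True
    then have "bij_betw f X X"
      using psubset.hyps(1) by (simp add: bij_betw_def eq_card_imp_inj_on)
    then show ?thesis using psubset.prems by blast
  next
    case False
    then have "f ` X \<subset> X" "f ` X \<noteq> {}" "f ` f ` X \<subseteq> f ` X"
      using psubset.prems by auto
    then obtain Y where "Y \<subseteq> f ` X" "Y \<noteq> {}" "bij_betw f Y Y"
      using psubset.IH by meson
    then show ?thesis using psubset.prems by blast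
  qed
qed

lemma permutation_of_relation:
  assumes "finite X" "X \<noteq> {}" "\<And>x. x \<in> X \<Longrightarrow> \<exists>y \<in> X. P x y"
  obtains Y f where "Y \<subseteq> X" "Y \<noteq> {}" "bij_betw f Y Y" "\<forall>x \<in> Y. P x (f x)"
proof -
  obtain f where f: "\<And>x. x \<in> X \<Longrightarrow> f x \<in> X \<and> P x (f x)"
    using assms(3) by metis
  then obtain Y where "Y \<subseteq> X" "Y \<noteq> {}" "bij_betw f Y Y"
    using permutation_of_closed_set[of X f] assms by blast
  with f that show ?thesis by blast
qed

text \<open>
  \<open>f\<close> and \<open>g\<close> are successor and predecessor along the ear, \<open>p\<close> and \<open>q\<close> its first and last vertex;
  for a disjoint union of cycles, which is also admitted, \<open>p\<close> and \<open>q\<close> are irrelevant.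
\<close>

lemma ear_exists:
  fixes E :: "('a \<times> 'a) set"
  assumes "finite R" "R \<noteq> {}"
  obtains X f g p q where "X \<subseteq> R" "X \<noteq> {}"
    "\<forall>v \<in> X. (v, f v) \<in> E \<and> f v \<in> X \<and> g (f v) = v \<or> v = q \<and> (\<forall>w \<in> R. (v, w) \<notin> E)"
    "\<forall>v \<in> X. (g v, v) \<in> E \<and> g v \<in> X \<and> f (g v) = v \<or> v = p \<and> (\<forall>w \<in> R. (w, v) \<notin> E)"
proof (cases "\<exists>X f. X \<subseteq> R \<and> X \<noteq> {} \<and> bij_betw f X X \<and> (\<forall>v \<in> X. (v, f v) \<in> E)")
  case True
  then obtain X f where X: "X \<subseteq> R" "X \<noteq> {}" "bij_betw f X X" and f: "\<And>v. v \<in> X \<Longrightarrow> (v, f v) \<in> E"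
    by blast
  define g where "g = inv_into X f"
  have g: "g v \<in> X" "f (g v) = v" "g (f v) = v" "f v \<in> X" if "v \<in> X" for v
    using that X(3) unfolding g_def
    by (auto simp: bij_betw_def inv_into_into f_inv_into_f)
  have g_arc: "(g v, v) \<in> E" if "v \<in> X" for v
    using f[of "g v"] g[OF that] by simp
  show ?thesis
    by (rule that[of X f g]) (use X(1,2) f g g_arc in auto)
next
  case acyclic: False
  have no_cycle: False
    if "X \<subseteq> R" "X \<noteq> {}" "bij_betw f X X" "\<forall>v \<in> X. (v, f v) \<in> E" for X f
    using acyclic that by blast
  \<comment> \<open>Successors inside \<open>X\<close> for all of \<open>X\<close> would produce a
    directed cycle. This is used below against an endless walk and against a closed one.\<close>
  have out: "\<exists>v \<in> X. \<forall>w \<in> X. (v, w) \<notin> E" if X: "X \<subseteq> R" "X \<noteq> {}" for X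
  proof (rule ccontr)
    assume "\<not> ?thesis"
    then have succ: "\<And>v. v \<in> X \<Longrightarrow> \<exists>w \<in> X. (v, w) \<in> E" by blast
    have "finite X" using X(1) assms(1) by (rule finite_subset)
    from permutation_of_relation[OF this X(2) succ]
    obtain Y f where "Y \<subseteq> X" "Y \<noteq> {}" "bij_betw f Y Y" "\<forall>x \<in> Y. (x, f x) \<in> E" .
    with no_cycle[of Y f] X(1) show False by auto
  qed
  have "\<exists>v \<in> R. \<forall>w \<in> R. (w, v) \<notin> E"
  proof (rule ccontr)
    assume "\<not> ?thesis"
    then have pred: "\<And>v. v \<in> R \<Longrightarrow> \<exists>w \<in> R. (w, v) \<in> E" by blast
    from permutation_of_relation[OF assms pred]
    obtain Y f where Y: "Y \<subseteq> R" "Y \<noteq> {}" "bij_betw f Y Y" and f: "\<forall>x \<in> Y. (f x, x) \<in> E" .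
    \<comment> \<open>Here \<open>f\<close> selects predecessors, so its inverse permutes
      \<open>Y\<close> along the arcs.\<close>
    have "\<forall>v \<in> Y. (v, inv_into Y f v) \<in> E"
    proof
      fix v assume "v \<in> Y"
      then show "(v, inv_into Y f v) \<in> E"
        using bspec[OF f, of "inv_into Y f v"] Y(3)
        by (auto simp: bij_betw_def inv_into_into f_inv_into_f)
    qed
    with no_cycle[OF Y(1,2) bij_betw_inv_into[OF Y(3)]] show False by simp
  qed
  then obtain p where p: "p \<in> R" "\<forall>w \<in> R. (w, p) \<notin> E" by blast
  define sink where "sink v \<longleftrightarrow> (\<forall>w \<in> R. (v, w) \<notin> E)" for v
  \<comment> \<open>The walk from the source \<open>p\<close> follows \<open>f\<close> up to its
    first sink; the arbitrary value of \<open>f\<close> there is never followed.\<close>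
  define f where "f v = (SOME w. w \<in> R \<and> (v, w) \<in> E)" for v
  have f: "f v \<in> R \<and> (v, f v) \<in> E" if "\<not> sink v" for v
    unfolding f_def by (rule someI_ex) (use that sink_def in auto)
  define u where "u i = (f ^^ i) p" for i
  have u_Suc: "u (Suc i) = f (u i)" and u_0: "u 0 = p" for i
    by (simp_all add: u_def)
  have u_R_upto: "u i \<in> R" if "\<And>j. j < i \<Longrightarrow> \<not> sink (u j)" for i
    using that by (induction i) (auto simp: u_0 u_Suc p f)
  have ex: "\<exists>i. sink (u i)"
  proof (rule ccontr)
    assume no: "\<not> ?thesis"
    then have "range u \<subseteq> R" using u_R_upto by blast
    then obtain i where i: "\<forall>w \<in> range u. (u i, w) \<notin> E"
      using out[of "range u"] by blast
    have "(u i, u (Suc i)) \<in> E" using no f by (simp add: u_Suc)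
    with i show False by blast
  qed
  define n where "n = (LEAST i. sink (u i))"
  have n: "sink (u n)" "\<And>j. j < n \<Longrightarrow> \<not> sink (u j)"
    using ex unfolding n_def by (auto intro: LeastI_ex dest: not_less_Least)
  have u_R: "u i \<in> R" if "i \<le> n" for i
    using that n by (intro u_R_upto) auto
  \<comment> \<open>A repeated vertex would close a segment of the walk, each of whose vertices has
    its successor in the segment.\<close>
  have neq: "u i \<noteq> u j" if ij: "i < j" "j \<le> n" for i j
  proof
    assume eq: "u i = u j"
    let ?X = "u ` {i..<j}"
    have "?X \<subseteq> R" using ij u_R by auto
    moreover have "?X \<noteq> {}" using ij by auto
    ultimately obtain k where k: "i \<le> k" "k < j" "\<forall>w \<in> ?X. (u k, w) \<notin> E"
      using out[of ?X] by auto
    have "u (Suc k) \<in> ?X"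
    proof (cases "Suc k = j")
      case True
      then show ?thesis using eq ij by (metis atLeastLessThan_iff imageI le_refl)
    qed (use k in auto)
    moreover have "(u k, u (Suc k)) \<in> E"
      using f n k ij by (simp add: u_Suc)
    ultimately show False using k by blast
  qed
  then have inj: "inj_on u {..n}"
    by (intro inj_onI) (metis atMost_iff linorder_neqE_nat)
  \<comment> \<open>Truncated subtraction at index 0 gives \<open>g p = p\<close>; the second
    alternative covers \<open>p\<close>.\<close>
  define g where "g v = u (inv_into {..n} u v - 1)" for v
  have g: "g (u (Suc i)) = u i" if "i < n" for i
    using inj that by (simp add: g_def)
  show ?thesis
  proof (rule that[of "u ` {..n}" f g "u n" p]; (intro ballI)?)
    fix v assume "v \<in> u ` {..n}"
    then obtain i where i: "v = u i" "i \<le> n" by auto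
    show "(v, f v) \<in> E \<and> f v \<in> u ` {..n} \<and> g (f v) = v \<or> v = u n \<and> (\<forall>w \<in> R. (v, w) \<notin> E)"
    proof (cases "i = n")
      case False
      then have "f v = u (Suc i)" "Suc i \<le> n" "\<not> sink v" using i n by (auto simp: u_Suc)
      then show ?thesis using i f[of v] g[of i] by auto
    qed (use i n sink_def in auto)
    show "(g v, v) \<in> E \<and> g v \<in> u ` {..n} \<and> f (g v) = v \<or> v = p \<and> (\<forall>w \<in> R. (w, v) \<notin> E)"
    proof (cases i)
      case (Suc j)
      then have "g v = u j" "j < n" using i g[of j] by auto
      moreover have "(u j, v) \<in> E" using n(2) f i Suc \<open>j < n\<close> by (simp add: u_Suc)
      ultimately show ?thesis using i Suc by (auto simp: u_Suc)
    qed (use i p u_0 in auto)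
  qed (use u_R in auto)
qed

section \<open>Attaching ears with three colors\<close>

definition third_color :: "nat \<Rightarrow> nat \<Rightarrow> nat" where
  "third_color a b = (SOME k. k \<in> {1..3} \<and> k \<noteq> a \<and> k \<noteq> b)"

lemma third_color: "third_color a b \<in> {1..3}" "third_color a b \<noteq> a" "third_color a b \<noteq> b"
proof -
  have "\<exists>k. k \<in> {1..3} \<and> k \<noteq> a \<and> k \<noteq> b"
    by (cases "a = 1 \<or> b = 1"; cases "a = 2 \<or> b = 2") (auto intro: exI[of _ 1] exI[of _ 2] exI[of _ 3])
  from someI_ex[OF this, folded third_color_def]
  show "third_color a b \<in> {1..3}" "third_color a b \<noteq> a" "third_color a b \<noteq> b" by auto
qed

text \<open>
  Here \<open>c\<close> colors the vertices and \<open>\<psi>\<close> the arcs, and \<open>W\<close> is the union of the ears chosen so far.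
  Vertices without out- or in-neighbors are judged in the whole of \<open>E\<close>, not in \<open>W\<close>.
\<close>

definition properly_marked where
  "properly_marked E W c \<psi> \<longleftrightarrow> range \<psi> \<subseteq> {1..3::nat} \<and> range c \<subseteq> {1..3} \<and>
    (\<forall>v \<in> W. ((\<exists>w. (v, w) \<in> E) \<longrightarrow> (\<exists>!w. w \<in> W \<and> (v, w) \<in> E \<and> \<psi> (v, w) = c v)) \<and>
             ((\<exists>w. (w, v) \<in> E) \<longrightarrow> (\<exists>!w. w \<in> W \<and> (w, v) \<in> E \<and> \<psi> (w, v) = c v)))"

text \<open>The color of the new ear avoids those of the old vertices it touches, and all other new
  arcs avoid the colors of both ends, so the unique marked arcs at old vertices stay unique.\<close>

lemma properly_marked_extend:
  fixes E :: "('a \<times> 'a) set"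
  assumes "properly_marked E W c \<psi>" "finite A" "E \<subseteq> A \<times> A" "W \<subset> A"
  shows "\<exists>W' c' \<psi>'. W \<subset> W' \<and> W' \<subseteq> A \<and> properly_marked E W' c' \<psi>'"
proof -
  note marked = assms(1)[unfolded properly_marked_def]
  have "finite (A - W)" "A - W \<noteq> {}" using assms by auto
  from ear_exists[OF this, of E] obtain X f g p q where X: "X \<subseteq> A - W" "X \<noteq> {}"
    and f: "\<forall>v \<in> X. (v, f v) \<in> E \<and> f v \<in> X \<and> g (f v) = v \<or> v = q \<and> (\<forall>w \<in> A - W. (v, w) \<notin> E)"
    and g: "\<forall>v \<in> X. (g v, v) \<in> E \<and> g v \<in> X \<and> f (g v) = v \<or> v = p \<and> (\<forall>w \<in> A - W. (w, v) \<notin> E)" .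
  \<comment> \<open>Old neighbors for the ends of a path. If there is none, the choice is arbitrary,
    and a resulting attaching pair in \<open>S\<close> is not an arc.\<close>
  define i where "i = (SOME w. w \<in> W \<and> (w, p) \<in> E)"
  define j where "j = (SOME w. w \<in> W \<and> (q, w) \<in> E)"
  define a where "a = third_color (c i) (c j)"
  define c' where "c' v = (if v \<in> X then a else c v)" for v
  \<comment> \<open>The pairs that get the color of the ear. Inner pairs satisfy both
    \<open>w = f v\<close> and \<open>g w = v\<close>, so each end determines the other. The
    maximality conditions exclude attaching pairs on cycles, where \<open>p\<close> and
    \<open>q\<close> are arbitrary.\<close>
  define S where "S = {(v, w). v \<in> X \<and> w \<in> X \<and> w = f v \<and> g w = v} \<union>
    {(v, w). v \<in> X \<and> v = q \<and> w = j \<and> (\<forall>w \<in> A - W. (q, w) \<notin> E)} \<union>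
    {(v, w). w \<in> X \<and> w = p \<and> v = i \<and> (\<forall>w \<in> A - W. (w, p) \<notin> E)}"
  define \<psi>' where "\<psi>' = (\<lambda>(v, w). if v \<in> W \<and> w \<in> W then \<psi> (v, w)
    else if (v, w) \<in> S then a else third_color (c' v) (c' w))"
  have i: "i \<in> W \<and> (i, p) \<in> E" if "w \<in> W" "(w, p) \<in> E" for w
    unfolding i_def by (rule someI[of _ w]) (use that in auto)
  have j: "j \<in> W \<and> (q, j) \<in> E" if "w \<in> W" "(q, w) \<in> E" for w
    unfolding j_def by (rule someI[of _ w]) (use that in auto)
  have disj: "v \<notin> W" if "v \<in> X" for v using X that by blast
  have a: "a \<in> {1..3}" "a \<noteq> c i" "a \<noteq> c j" using third_color by (auto simp: a_def)
  have old_c: "c' v = c v" if "v \<in> W" for v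
    using that disj by (auto simp: c'_def)
  have old_\<psi>: "\<psi>' (v, w) = \<psi> (v, w)" if "v \<in> W" "w \<in> W" for v w
    using that by (simp add: \<psi>'_def)
  \<comment> \<open>Pairs of \<open>S\<close> meet \<open>W\<close> only in \<open>i\<close> and
    \<open>j\<close>, whose colors differ from \<open>a\<close>.\<close>
  have old_out: "\<psi>' (v, w) \<noteq> c' v" if "v \<in> W" "w \<in> X" for v w
    using that disj a third_color by (auto simp: \<psi>'_def S_def c'_def)
  have old_in: "\<psi>' (w, v) \<noteq> c' v" if "v \<in> W" "w \<in> X" for v w
    using that disj a third_color by (auto simp: \<psi>'_def S_def c'_def)
  have new_out: "\<psi>' (v, w) = c' v \<longleftrightarrow> (v, w) \<in> S" if "v \<in> X" for v w
    using that disj a third_color by (auto simp: \<psi>'_def c'_def)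
  have new_in: "\<psi>' (w, v) = c' v \<longleftrightarrow> (w, v) \<in> S" if "v \<in> X" for v w
    using that disj a third_color by (auto simp: \<psi>'_def c'_def)
  have "properly_marked E (W \<union> X) c' \<psi>'"
    unfolding properly_marked_def
  proof (intro conjI ballI impI)
    show "range \<psi>' \<subseteq> {1..3}"
      using marked a third_color(1) by (auto simp: \<psi>'_def)
    show "range c' \<subseteq> {1..3}"
      using marked a by (auto simp: c'_def)
  next
    fix v assume v: "v \<in> W \<union> X" and ex: "\<exists>w. (v, w) \<in> E"
    show "\<exists>!w. w \<in> W \<union> X \<and> (v, w) \<in> E \<and> \<psi>' (v, w) = c' v"
    proof (cases "v \<in> W")
      case True
      then have "w \<in> W \<union> X \<and> (v, w) \<in> E \<and> \<psi>' (v, w) = c' v \<longleftrightarrow>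
          w \<in> W \<and> (v, w) \<in> E \<and> \<psi> (v, w) = c v" for w
        using old_out[of v w] old_c[of v] old_\<psi>[of v w] by auto
      then show ?thesis using marked True ex by simp
    next
      case False
      then have vX: "v \<in> X" using v by simp
      show ?thesis
      proof (cases "(v, f v) \<in> E \<and> f v \<in> X \<and> g (f v) = v")
        case True
        \<comment> \<open>Attaching pairs are ruled out, since both \<open>v\<close> and
          \<open>f v\<close> lie outside \<open>W\<close>.\<close>
        then have "(v, w) \<in> S \<longleftrightarrow> w = f v" if "(v, w) \<in> E" for w
          using vX X disj that g unfolding S_def by (auto 0 3)
        then show ?thesis using True new_out[OF vX] by (metis UnCI)
      next
        case nf: False
        then have q: "v = q" "\<forall>w \<in> A - W. (v, w) \<notin> E" using bspec[OF f vX] by auto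
        then have jW: "j \<in> W" "(q, j) \<in> E" using ex j assms(3) by blast+
        have "(v, w) \<in> S \<longleftrightarrow> w = j" if "(v, w) \<in> E" for w
          using that q vX nf X disj unfolding S_def by auto
        then show ?thesis using jW q new_out[OF vX] by (metis UnCI)
      qed
    qed
  next
    fix v assume v: "v \<in> W \<union> X" and ex: "\<exists>w. (w, v) \<in> E"
    show "\<exists>!w. w \<in> W \<union> X \<and> (w, v) \<in> E \<and> \<psi>' (w, v) = c' v"
    proof (cases "v \<in> W")
      case True
      then have "w \<in> W \<union> X \<and> (w, v) \<in> E \<and> \<psi>' (w, v) = c' v \<longleftrightarrow>
          w \<in> W \<and> (w, v) \<in> E \<and> \<psi> (w, v) = c v" for w
        using old_in[of v w] old_c[of v] old_\<psi>[of w v] by auto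
      then show ?thesis using marked True ex by simp
    next
      case False
      then have vX: "v \<in> X" using v by simp
      show ?thesis
      proof (cases "(g v, v) \<in> E \<and> g v \<in> X \<and> f (g v) = v")
        case True
        then have "(w, v) \<in> S \<longleftrightarrow> w = g v" if "(w, v) \<in> E" for w
          using vX X disj that f unfolding S_def by (auto 0 3)
        then show ?thesis using True new_in[OF vX] by (metis UnCI)
      next
        case nf: False
        then have p: "v = p" "\<forall>w \<in> A - W. (w, v) \<notin> E" using bspec[OF g vX] by auto
        then have iW: "i \<in> W" "(i, p) \<in> E" using ex i assms(3) by blast+
        have "(w, v) \<in> S \<longleftrightarrow> w = i" if "(w, v) \<in> E" for w
          using that p vX nf X disj unfolding S_def by auto
        then show ?thesis using iW p new_in[OF vX] by (metis UnCI)
      qed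
    qed
  qed
  then show ?thesis using X assms(4) by (intro exI[of _ "W \<union> X"]) blast
qed

text \<open>A maximal marked set is everything, since otherwise another ear could be
  attached.\<close>

lemma properly_marked_exists:
  fixes E :: "('a \<times> 'a) set"
  assumes "finite A" "E \<subseteq> A \<times> A"
  shows "\<exists>c \<psi>. properly_marked E A c \<psi>"
proof -
  let ?P = "\<lambda>W. W \<subseteq> A \<and> (\<exists>c \<psi>. properly_marked E W c \<psi>)"
  have "?P {}" by (auto simp: properly_marked_def intro!: exI[of _ "\<lambda>_. 1"])
  then have ne: "Collect ?P \<noteq> {}" by blast
  have "finite (Collect ?P)"
    by (rule finite_subset[of _ "Pow A"]) (use assms in auto)
  from finite_has_maximal[OF this ne]
  obtain W where W: "?P W" "\<And>W'. ?P W' \<Longrightarrow> W \<subseteq> W' \<Longrightarrow> W = W'" by auto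
  have "W = A"
  proof (rule ccontr)
    assume "W \<noteq> A"
    with W(1) obtain c \<psi> where "properly_marked E W c \<psi>" "W \<subset> A" by blast
    from properly_marked_extend[OF this(1) assms this(2)]
    obtain W' where "W \<subset> W'" "?P W'" by blast
    with W(2)[of W'] show False by blast
  qed
  with W show ?thesis by blast
qed

section \<open>Parity counts\<close>

text \<open>The arcs \<open>A\<close> of a blow-up lie over the arcs \<open>B\<close> of the base.
  Exchanging \<open>t\<close>, \<open>T\<close> with \<open>h\<close>, \<open>H\<close> turns facts
  on leaving arcs into facts on entering arcs, so only one direction is treated.\<close>

locale odd_blowup =
  fixes A :: "'d set" and B :: "'b set" and \<pi> :: "'d \<Rightarrow> 'b"
    and t h :: "'d \<Rightarrow> 'c" and T H :: "'b \<Rightarrow> 'a" and V :: "'a set" and I :: "'a \<Rightarrow> 'c set"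
  assumes finite_A: "finite A" and finite_B: "finite B"
    and \<pi>_in: "a \<in> A \<Longrightarrow> \<pi> a \<in> B"
    and t_in: "a \<in> A \<Longrightarrow> t a \<in> I (T (\<pi> a))"
    and T_in: "e \<in> B \<Longrightarrow> T e \<in> V" and H_in: "e \<in> B \<Longrightarrow> H e \<in> V"
    and fibre: "e \<in> B \<Longrightarrow> bij_betw (\<lambda>a. (t a, h a)) {a \<in> A. \<pi> a = e} (I (T e) \<times> I (H e))"
    and disj: "disjoint_family_on I V"
    and finite_I: "v \<in> V \<Longrightarrow> finite (I v)" and odd_I: "v \<in> V \<Longrightarrow> odd (card (I v))"
begin

lemma class_unique: "v \<in> V \<Longrightarrow> w \<in> V \<Longrightarrow> x \<in> I v \<Longrightarrow> x \<in> I w \<Longrightarrow> v = w"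
  using disj by (auto simp: disjoint_family_on_def)

lemma odd_fibre: "e \<in> B \<Longrightarrow> odd (card {a \<in> A. \<pi> a = e})"
  using bij_betw_same_card[OF fibre] odd_I T_in H_in by (simp add: card_cartesian_product)

lemma odd_fibre_at:
  assumes "e \<in> B" "x \<in> I (T e)"
  shows "odd (card {a \<in> A. \<pi> a = e \<and> t a = x})"
proof -
  have bij: "bij_betw (\<lambda>a. (t a, h a)) {a \<in> A. \<pi> a = e} (I (T e) \<times> I (H e))"
    using assms(1) by (rule fibre)
  have "bij_betw h {a \<in> A. \<pi> a = e \<and> t a = x} (I (H e))"
  proof (rule bij_betw_imageI)
    show "inj_on h {a \<in> A. \<pi> a = e \<and> t a = x}"
      using bij by (auto simp: bij_betw_def inj_on_def)
    have "y \<in> h ` {a \<in> A. \<pi> a = e \<and> t a = x}" if "y \<in> I (H e)" for y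
    proof -
      have "(x, y) \<in> (\<lambda>a. (t a, h a)) ` {a \<in> A. \<pi> a = e}"
        using bij assms(2) that by (auto simp: bij_betw_def)
      then show ?thesis by auto
    qed
    then show "h ` {a \<in> A. \<pi> a = e \<and> t a = x} = I (H e)"
      using bij by (fastforce simp: bij_betw_def)
  qed
  then show ?thesis using bij_betw_same_card odd_I H_in assms(1) by metis
qed

text \<open>The arcs at \<open>x\<close> split into blocks over the arcs at \<open>v\<close>, each
  of odd size. \<open>P\<close> will be a color condition, or trivial to compare degrees.\<close>

lemma odd_pullback_count:
  assumes "v \<in> V" "x \<in> I v"
  shows "odd (card {a \<in> A. t a = x \<and> P (\<pi> a)}) \<longleftrightarrow> odd (card {e \<in> B. T e = v \<and> P e})"
proof -
  let ?C = "{e \<in> B. T e = v \<and> P e}"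
  let ?F = "\<lambda>e. {a \<in> A. \<pi> a = e \<and> t a = x}"
  have "T (\<pi> a) = v" if "a \<in> A" "t a = x" for a
    using that assms class_unique t_in T_in \<pi>_in by metis
  then have "{a \<in> A. t a = x \<and> P (\<pi> a)} = (\<Union>e \<in> ?C. ?F e)"
    using \<pi>_in by auto
  also have "card \<dots> = (\<Sum>e \<in> ?C. card (?F e))"
    by (rule card_UN_disjoint) (use finite_A finite_B in auto)
  finally have "odd (card {a \<in> A. t a = x \<and> P (\<pi> a)}) \<longleftrightarrow> odd (card {e \<in> ?C. odd (card (?F e))})"
    using finite_B by (simp add: even_sum_iff)
  moreover have "{e \<in> ?C. odd (card (?F e))} = ?C"
    using odd_fibre_at assms by auto
  ultimately show ?thesis by simp
qed

text \<open>Empty semi-cuts are exempt from (WO), so emptiness must be transferred too; a block of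
  odd size is nonempty.\<close>

lemma empty_cut_iff:
  assumes "v \<in> V" "x \<in> I v"
  shows "{a \<in> A. t a = x} = {} \<longleftrightarrow> {e \<in> B. T e = v} = {}"
proof
  assume empty: "{a \<in> A. t a = x} = {}"
  have "\<not> (e \<in> B \<and> T e = v)" for e
  proof
    assume "e \<in> B \<and> T e = v"
    then have "odd (card {a \<in> A. \<pi> a = e \<and> t a = x})"
      using odd_fibre_at assms(2) by blast
    moreover have "{a \<in> A. \<pi> a = e \<and> t a = x} = {}" using empty by auto
    ultimately show False by (metis card.empty even_zero)
  qed
  then show "{e \<in> B. T e = v} = {}" by blast
next
  assume "{e \<in> B. T e = v} = {}"
  moreover have "T (\<pi> a) = v" "\<pi> a \<in> B" if "a \<in> A" "t a = x" for a
    using that assms class_unique t_in T_in \<pi>_in by metis+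
  ultimately show "{a \<in> A. t a = x} = {}" by blast
qed

text \<open>Double counting of the arcs with \<open>Q\<close> at all copies of \<open>v\<close>, by
  copy and by base arc; modulo 2 only the odd fibre counts matter.\<close>

lemma odd_pushforward_count:
  assumes "v \<in> V"
  shows "odd (card {e \<in> B. T e = v \<and> odd (card {a \<in> A. \<pi> a = e \<and> Q a})}) \<longleftrightarrow>
    odd (\<Sum>x \<in> I v. card {a \<in> A. t a = x \<and> Q a})"
proof -
  have "{a \<in> A. t a \<in> I v \<and> Q a} = {a \<in> A. T (\<pi> a) = v \<and> Q a}"
    using assms class_unique t_in T_in \<pi>_in by blast
  moreover have "{a \<in> A. t a \<in> I v \<and> Q a} = (\<Union>x \<in> I v. {a \<in> A. t a = x \<and> Q a})"
    by auto
  moreover have "card \<dots> = (\<Sum>x \<in> I v. card {a \<in> A. t a = x \<and> Q a})"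
    by (rule card_UN_disjoint) (use finite_A finite_I assms in auto)
  moreover have "{a \<in> A. T (\<pi> a) = v \<and> Q a} = (\<Union>e \<in> {e \<in> B. T e = v}. {a \<in> A. \<pi> a = e \<and> Q a})"
    using \<pi>_in by auto
  moreover have "card \<dots> = (\<Sum>e \<in> {e \<in> B. T e = v}. card {a \<in> A. \<pi> a = e \<and> Q a})"
    by (rule card_UN_disjoint) (use finite_A finite_B in auto)
  ultimately have "(\<Sum>x \<in> I v. card {a \<in> A. t a = x \<and> Q a}) =
      (\<Sum>e \<in> {e \<in> B. T e = v}. card {a \<in> A. \<pi> a = e \<and> Q a})"
    by simp
  then show ?thesis
    using finite_B by (simp add: even_sum_iff conj_assoc)
qed

end

lemma odd_sum_cong:
  fixes f g :: "'a \<Rightarrow> nat"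
  assumes "\<And>x. x \<in> X \<Longrightarrow> odd (f x) \<longleftrightarrow> odd (g x)"
  shows "odd (sum f X) \<longleftrightarrow> odd (sum g X)"
  using assms by (induction X rule: infinite_finite_induct) auto

lemma odd_sum_const_parity:
  fixes f :: "'a \<Rightarrow> nat"
  assumes "odd (card X)" "\<And>x. x \<in> X \<Longrightarrow> odd (f x) \<longleftrightarrow> p"
  shows "odd (sum f X) \<longleftrightarrow> p"
proof -
  have "odd (sum f X) \<longleftrightarrow> odd (\<Sum>x \<in> X. of_bool p :: nat)"
    using assms(2) by (intro odd_sum_cong) auto
  then show ?thesis using assms(1) by simp
qed

text \<open>\<open>X\<close> stands for the copies of a vertex, \<open>a\<close> and
  \<open>b\<close> for the color counts of its semi-cuts, \<open>P\<close> and \<open>Q\<close> for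
  their nonemptiness, \<open>p\<close> and \<open>q\<close> for the parities of their sizes. If a
  nonempty semi-cut has even size, both colors are odd at every copy, so both sums are odd and the
  other semi-cut decides. If both sizes are odd, (WO) makes the same single color odd in both
  semi-cuts at each copy, so their sums agree in parity.\<close>

lemma two_color_parity_sum:
  fixes a b :: "nat \<Rightarrow> 'c \<Rightarrow> nat"
  assumes X: "odd (card X)"
    and p: "\<And>x. x \<in> X \<Longrightarrow> odd (a 1 x + a 2 x) \<longleftrightarrow> p"
    and q: "\<And>x. x \<in> X \<Longrightarrow> odd (b 1 x + b 2 x) \<longleftrightarrow> q"
    and wo: "\<And>x. x \<in> X \<Longrightarrow> \<exists>i \<in> {1, 2}. (P \<longrightarrow> odd (a i x)) \<and> (Q \<longrightarrow> odd (b i x))"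
  shows "\<exists>i \<in> {1, 2}. (P \<longrightarrow> odd (sum (a i) X)) \<and> (Q \<longrightarrow> odd (sum (b i) X))"
proof -
  have A: "odd (sum (a 1) X + sum (a 2) X) \<longleftrightarrow> p"
    unfolding sum.distrib[symmetric] using X p by (rule odd_sum_const_parity)
  have B: "odd (sum (b 1) X + sum (b 2) X) \<longleftrightarrow> q"
    unfolding sum.distrib[symmetric] using X q by (rule odd_sum_const_parity)
  have a_even: "odd (sum (a i) X)" if "P" "\<not> p" "i \<in> {1, 2}" for i
    using odd_sum_const_parity[OF X, of "a i" True] that p wo by fastforce
  have b_even: "odd (sum (b i) X)" if "Q" "\<not> q" "i \<in> {1, 2}" for i
    using odd_sum_const_parity[OF X, of "b i" True] that q wo by fastforce
  consider "\<not> P \<or> \<not> p" | "\<not> Q \<or> \<not> q" | "P" "Q" "p" "q" by blast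
  then show ?thesis
  proof cases
    case 1
    then show ?thesis using a_even b_even B by (cases "Q \<and> q") auto
  next
    case 2
    then show ?thesis using a_even b_even A by (cases "P \<and> p") auto
  next
    case 3
    then have "odd (sum (a 1) X) \<longleftrightarrow> odd (sum (b 1) X)"
      using p q wo by (intro odd_sum_cong) fastforce
    then show ?thesis using A B 3 by (cases "odd (sum (a 1) X)") auto
  qed
qed

section \<open>Three colors suffice for every digraph\<close>

lemma WO_at_iff:
  "WO_at D k \<phi> v \<longleftrightarrow>
    {e \<in> arcs D. tail D e = v} = {} \<and> {e \<in> arcs D. head D e = v} = {} \<or>
    (\<exists>i \<in> {1..k}.
      ({e \<in> arcs D. tail D e = v} \<noteq> {} \<longrightarrow> odd (card {e \<in> arcs D. tail D e = v \<and> \<phi> e = i})) \<and>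
      ({e \<in> arcs D. head D e = v} \<noteq> {} \<longrightarrow> odd (card {e \<in> arcs D. head D e = v \<and> \<phi> e = i})))"
  unfolding WO_at_def semi_cuts_def out_arcs_def in_arcs_def by (simp add: conj_assoc)

lemma arc_dominates: "e \<in> arcs G \<Longrightarrow> tail G e \<rightarrow>\<^bsub>G\<^esub> head G e"
  by (auto simp: arcs_ends_conv)

text \<open>The witness at \<open>v\<close> is \<open>c v\<close>, occurring once in each nonempty
  semi-cut: without parallel arcs, a unique marked neighbor means a unique marked arc.\<close>

lemma (in digraph) weak_odd_3_edge_colorable: "\<exists>\<phi>. weak_odd_edge_coloring G 3 \<phi>"
proof -
  have "arcs_ends G \<subseteq> verts G \<times> verts G"
    by (auto simp: arcs_ends_conv)
  from properly_marked_exists[OF finite_verts this]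
  obtain c \<psi> where marked: "properly_marked (arcs_ends G) (verts G) c \<psi>" by blast
  define \<phi> where "\<phi> e = \<psi> (tail G e, head G e)" for e
  have "range \<psi> \<subseteq> {1..3}" "range c \<subseteq> {1..3}"
    using marked by (simp_all add: properly_marked_def)
  then have \<phi>_range: "\<phi> e \<in> {1..3}" and color: "c v \<in> {1..3}" for e v
    unfolding \<phi>_def by blast+
  have arc_eq: "e = e'"
    if "e \<in> arcs G" "e' \<in> arcs G" "tail G e = tail G e'" "head G e = head G e'" for e e'
    using that no_multi_arcs by (simp add: arc_to_ends_def)
  have out: "card {e \<in> arcs G. tail G e = v \<and> \<phi> e = c v} = 1"
    if v: "v \<in> verts G" "{e \<in> arcs G. tail G e = v} \<noteq> {}" for v
  proof -
    have "\<exists>w. (v, w) \<in> arcs_ends G"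
      using v(2) by (auto simp: arcs_ends_conv)
    then have ex1: "\<exists>!w. w \<in> verts G \<and> (v, w) \<in> arcs_ends G \<and> \<psi> (v, w) = c v"
      using marked v(1) by (auto simp: properly_marked_def)
    then obtain e where e: "e \<in> arcs G" "tail G e = v" "\<phi> e = c v"
      by (auto simp: arcs_ends_conv \<phi>_def)
    have "e' = e" if "e' \<in> arcs G" "tail G e' = v" "\<phi> e' = c v" for e'
    proof (rule arc_eq)
      show "head G e' = head G e"
        using ex1 e that head_in_verts arc_dominates unfolding \<phi>_def by metis
    qed (use e that in auto)
    then have "{e \<in> arcs G. tail G e = v \<and> \<phi> e = c v} = {e}" using e by blast
    then show ?thesis by simp
  qed
  have into: "card {e \<in> arcs G. head G e = v \<and> \<phi> e = c v} = 1"
    if v: "v \<in> verts G" "{e \<in> arcs G. head G e = v} \<noteq> {}" for v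
  proof -
    have "\<exists>w. (w, v) \<in> arcs_ends G"
      using v(2) by (auto simp: arcs_ends_conv)
    then have ex1: "\<exists>!w. w \<in> verts G \<and> (w, v) \<in> arcs_ends G \<and> \<psi> (w, v) = c v"
      using marked v(1) by (auto simp: properly_marked_def)
    then obtain e where e: "e \<in> arcs G" "head G e = v" "\<phi> e = c v"
      by (auto simp: arcs_ends_conv \<phi>_def)
    have "e' = e" if "e' \<in> arcs G" "head G e' = v" "\<phi> e' = c v" for e'
    proof (rule arc_eq)
      show "tail G e' = tail G e"
        using ex1 e that tail_in_verts arc_dominates unfolding \<phi>_def by metis
    qed (use e that in auto)
    then have "{e \<in> arcs G. head G e = v \<and> \<phi> e = c v} = {e}" using e by blast
    then show ?thesis by simp
  qed
  have "weak_odd_edge_coloring G 3 \<phi>"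
    unfolding weak_odd_edge_coloring_def
  proof (intro conjI ballI)
    show "\<phi> ` arcs G \<subseteq> {1..3}"
      using \<phi>_range by blast
    show "WO_at G 3 \<phi> v" if "v \<in> verts G" for v
      unfolding WO_at_iff
      by (intro disjI2 bexI[of _ "c v"] conjI impI) (use out[OF that] into[OF that] color in simp_all)
  qed
  then show ?thesis by blast
qed

lemma weak_odd_edge_coloring_mono:
  "weak_odd_edge_coloring D k \<phi> \<Longrightarrow> k \<le> l \<Longrightarrow> weak_odd_edge_coloring D l \<phi>"
  unfolding weak_odd_edge_coloring_def WO_at_def by fastforce

section \<open>Transfer of colorings between \<open>D\<close> and \<open>ED\<close>\<close>

text \<open>Disjointness of the classes determines the ends of the arc below, and the absence of
  parallel arcs the arc itself. The second instance is the reversal, for entering arcs.\<close>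

lemma extended_digraph_blowup:
  assumes D: "digraph D" and ext: "extended_digraph D s I ED"
    and s: "\<And>v. v \<in> verts D \<Longrightarrow> odd (s v)"
  obtains \<pi> where
    "odd_blowup (arcs ED) (arcs D) \<pi> (tail ED) (head ED) (tail D) (head D) (verts D) I"
    "odd_blowup (arcs ED) (arcs D) \<pi> (head ED) (tail ED) (head D) (tail D) (verts D) I"
proof -
  interpret D: digraph D by fact
  interpret E: digraph ED using ext by (simp add: extended_digraph_def)
  have verts: "verts ED = (\<Union>v \<in> verts D. I v)"
    and disj: "disjoint_family_on I (verts D)"
    and I: "\<And>v. v \<in> verts D \<Longrightarrow> finite (I v) \<and> card (I v) = s v"
    and dom: "\<And>u v x y. u \<in> verts D \<Longrightarrow> v \<in> verts D \<Longrightarrow> x \<in> I u \<Longrightarrow> y \<in> I v \<Longrightarrow>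
      x \<rightarrow>\<^bsub>ED\<^esub> y \<longleftrightarrow> u \<rightarrow>\<^bsub>D\<^esub> v"
    using ext by (auto simp: extended_digraph_def)
  have unique: "u = v" if "u \<in> verts D" "v \<in> verts D" "x \<in> I u" "x \<in> I v" for u v x
    using that disj by (auto simp: disjoint_family_on_def)
  have "\<exists>e \<in> arcs D. tail ED a \<in> I (tail D e) \<and> head ED a \<in> I (head D e)" if a: "a \<in> arcs ED" for a
  proof -
    have "tail ED a \<in> verts ED" "head ED a \<in> verts ED" using a by auto
    then obtain u v where uv: "u \<in> verts D" "v \<in> verts D" "tail ED a \<in> I u" "head ED a \<in> I v"
      using verts by auto
    moreover have "tail ED a \<rightarrow>\<^bsub>ED\<^esub> head ED a" using a by (rule arc_dominates)
    ultimately have "u \<rightarrow>\<^bsub>D\<^esub> v" using dom by blast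
    then show ?thesis using uv by (auto simp: arcs_ends_conv)
  qed
  then obtain \<pi> where \<pi>: "\<And>a. a \<in> arcs ED \<Longrightarrow>
      \<pi> a \<in> arcs D \<and> tail ED a \<in> I (tail D (\<pi> a)) \<and> head ED a \<in> I (head D (\<pi> a))"
    by metis
  have fibre: "bij_betw (\<lambda>a. (tail ED a, head ED a)) {a \<in> arcs ED. \<pi> a = e}
      (I (tail D e) \<times> I (head D e))" if e: "e \<in> arcs D" for e
  proof (rule bij_betw_imageI)
    show "inj_on (\<lambda>a. (tail ED a, head ED a)) {a \<in> arcs ED. \<pi> a = e}"
      using E.no_multi_arcs by (auto simp: inj_on_def arc_to_ends_def)
    have "(x, y) \<in> (\<lambda>a. (tail ED a, head ED a)) ` {a \<in> arcs ED. \<pi> a = e}"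
      if xy: "x \<in> I (tail D e)" "y \<in> I (head D e)" for x y
    proof -
      have "x \<rightarrow>\<^bsub>ED\<^esub> y" using dom[OF _ _ xy] e arc_dominates[OF e] by simp
      then obtain a where a: "a \<in> arcs ED" "x = tail ED a" "y = head ED a"
        by (auto simp: arcs_ends_conv)
      then have "tail D (\<pi> a) = tail D e" "head D (\<pi> a) = head D e"
        using unique \<pi>[of a] e xy D.tail_in_verts D.head_in_verts by metis+
      then have "\<pi> a = e" using D.no_multi_arcs \<pi> a(1) e by (simp add: arc_to_ends_def)
      then show ?thesis using a by auto
    qed
    then show "(\<lambda>a. (tail ED a, head ED a)) ` {a \<in> arcs ED. \<pi> a = e} = I (tail D e) \<times> I (head D e)"
      using \<pi> by auto
  qed
  have "bij_betw (prod.swap \<circ> (\<lambda>a. (tail ED a, head ED a))) {a \<in> arcs ED. \<pi> a = e}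
      (I (head D e) \<times> I (tail D e))" if "e \<in> arcs D" for e
    using fibre[OF that] by (rule bij_betw_trans) (simp add: bij_betw_def product_swap)
  then have fibre': "bij_betw (\<lambda>a. (head ED a, tail ED a)) {a \<in> arcs ED. \<pi> a = e}
      (I (head D e) \<times> I (tail D e))" if "e \<in> arcs D" for e
    using that by (simp add: comp_def)
  show ?thesis
    by (rule that[of \<pi>]; unfold_locales) (use \<pi> fibre fibre' disj I s in auto)
qed

text \<open>Emptiness of semi-cuts and parities of color counts agree at a copy and at the original
  vertex, so (WO) is the same condition at both.\<close>

lemma weak_odd_pullback:
  assumes out: "odd_blowup (arcs ED) (arcs D) \<pi> (tail ED) (head ED) (tail D) (head D) (verts D) I"
    and into: "odd_blowup (arcs ED) (arcs D) \<pi> (head ED) (tail ED) (head D) (tail D) (verts D) I"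
    and verts: "verts ED = (\<Union>v \<in> verts D. I v)"
    and col: "weak_odd_edge_coloring D k \<phi>"
  shows "weak_odd_edge_coloring ED k (\<phi> \<circ> \<pi>)"
  unfolding weak_odd_edge_coloring_def
proof (intro conjI ballI)
  show "(\<phi> \<circ> \<pi>) ` arcs ED \<subseteq> {1..k}"
    using col odd_blowup.\<pi>_in[OF out] by (auto simp: weak_odd_edge_coloring_def)
  fix x assume "x \<in> verts ED"
  then obtain v where v: "v \<in> verts D" "x \<in> I v" using verts by blast
  have "WO_at D k \<phi> v" using col v(1) by (simp add: weak_odd_edge_coloring_def)
  then show "WO_at ED k (\<phi> \<circ> \<pi>) x"
    unfolding WO_at_iff comp_def
      odd_blowup.empty_cut_iff[OF out v] odd_blowup.empty_cut_iff[OF into v]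
      odd_blowup.odd_pullback_count[OF out v, where P = "\<lambda>e. \<phi> e = _"]
      odd_blowup.odd_pullback_count[OF into v, where P = "\<lambda>e. \<phi> e = _"] .
qed

text \<open>An odd fibre split into at most two color counts has exactly one odd count, which gives
  the new color; three counts could all be odd.\<close>

lemma weak_odd_pushforward:
  assumes out: "odd_blowup (arcs ED) (arcs D) \<pi> (tail ED) (head ED) (tail D) (head D) (verts D) I"
    and into: "odd_blowup (arcs ED) (arcs D) \<pi> (head ED) (tail ED) (head D) (tail D) (verts D) I"
    and verts: "verts ED = (\<Union>v \<in> verts D. I v)"
    and col: "weak_odd_edge_coloring ED k \<phi>" and k: "k \<le> 2"
  shows "\<exists>\<phi>'. weak_odd_edge_coloring D k \<phi>'"
proof -
  interpret out: odd_blowup "arcs ED" "arcs D" \<pi> "tail ED" "head ED" "tail D" "head D" "verts D" I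
    by fact
  interpret into: odd_blowup "arcs ED" "arcs D" \<pi> "head ED" "tail ED" "head D" "tail D" "verts D" I
    by fact
  have range: "\<phi> a \<in> {1..k}" if "a \<in> arcs ED" for a
    using col that by (auto simp: weak_odd_edge_coloring_def)
  have split: "card {a \<in> arcs ED. Q a} = (\<Sum>i = 1..k. card {a \<in> arcs ED. Q a \<and> \<phi> a = i})" for Q
  proof -
    have "{a \<in> arcs ED. Q a} = (\<Union>i \<in> {1..k}. {a \<in> arcs ED. Q a \<and> \<phi> a = i})"
      using range by auto
    also have "card \<dots> = (\<Sum>i = 1..k. card {a \<in> arcs ED. Q a \<and> \<phi> a = i})"
      by (rule card_UN_disjoint) (use out.finite_A in auto)
    finally show ?thesis .
  qed
  define N where "N i e = card {a \<in> arcs ED. \<pi> a = e \<and> \<phi> a = i}" for i e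
  \<comment> \<open>The value 2 is not taken on arcs for \<open>k = 1\<close>, where
    \<open>N 1 e\<close> is the whole odd fibre; for \<open>k = 0\<close> there are no arcs, an
    empty sum being even.\<close>
  define \<phi>' where "\<phi>' e = (if odd (N 1 e) then 1 else 2 :: nat)" for e
  have odd_N: "odd (\<Sum>i = 1..k. N i e)" if "e \<in> arcs D" for e
    using out.odd_fibre[OF that] split[of "\<lambda>a. \<pi> a = e"] by (simp add: N_def)
  consider "k = 0" | "k = 1" | "k = 2" using k by linarith
  note k_cases = this
  have k2: "{1..2} = {1, 2::nat}" "{Suc 0..2} = {Suc 0, 2}" by auto
  have \<phi>'_range: "\<phi>' e \<in> {1..k}" if "e \<in> arcs D" for e
    using k_cases odd_N[OF that] by cases (auto simp: \<phi>'_def)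
  have \<phi>'_iff: "\<phi>' e = i \<longleftrightarrow> odd (N i e)" if "e \<in> arcs D" "i \<in> {1..k}" for e i
    using k_cases
  proof cases
    case 3
    then show ?thesis using odd_N[OF that(1)] that(2) by (auto simp add: \<phi>'_def k2 simp del: atLeastAtMost_iff)
  qed (use odd_N[OF that(1)] that(2) in \<open>auto simp: \<phi>'_def\<close>)
  have "WO_at D k \<phi>' v" if v: "v \<in> verts D" for v
  proof -
    let ?O = "{e \<in> arcs D. tail D e = v} \<noteq> {}" and ?N = "{e \<in> arcs D. head D e = v} \<noteq> {}"
    define a where "a i x = card {a \<in> arcs ED. tail ED a = x \<and> \<phi> a = i}" for i x
    define b where "b i x = card {a \<in> arcs ED. head ED a = x \<and> \<phi> a = i}" for i x
    have A: "odd (card {e \<in> arcs D. tail D e = v \<and> \<phi>' e = i}) \<longleftrightarrow> odd (sum (a i) (I v))"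
      if "i \<in> {1..k}" for i
      using out.odd_pushforward_count[OF v, of "\<lambda>a. \<phi> a = i"] \<phi>'_iff that
      by (simp add: a_def N_def cong: conj_cong)
    have B: "odd (card {e \<in> arcs D. head D e = v \<and> \<phi>' e = i}) \<longleftrightarrow> odd (sum (b i) (I v))"
      if "i \<in> {1..k}" for i
      using into.odd_pushforward_count[OF v, of "\<lambda>a. \<phi> a = i"] \<phi>'_iff that
      by (simp add: b_def N_def cong: conj_cong)
    have wo: "\<not> ?O \<and> \<not> ?N \<or> (\<exists>i \<in> {1..k}. (?O \<longrightarrow> odd (a i x)) \<and> (?N \<longrightarrow> odd (b i x)))"
      if x: "x \<in> I v" for x
    proof -
      have "WO_at ED k \<phi> x"
        using col verts v x by (auto simp: weak_odd_edge_coloring_def)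
      then show ?thesis
        unfolding WO_at_iff out.empty_cut_iff[OF v x] into.empty_cut_iff[OF v x]
          a_def[symmetric] b_def[symmetric] by simp
    qed
    have X: "odd (card (I v))" using v by (rule out.odd_I)
    have "\<exists>i \<in> {1..k}. (?O \<longrightarrow> odd (sum (a i) (I v))) \<and> (?N \<longrightarrow> odd (sum (b i) (I v)))"
      if ON: "?O \<or> ?N"
      using k_cases
    proof cases
      case 1
      then show ?thesis using ON \<phi>'_range by fastforce
    next
      case 2
      \<comment> \<open>The only color is odd in the nonempty semi-cuts of every copy, and there are
        oddly many copies.\<close>
      then have "?O \<Longrightarrow> odd (sum (a 1) (I v))" "?N \<Longrightarrow> odd (sum (b 1) (I v))"
        using odd_sum_const_parity[OF X, of "a 1" True] odd_sum_const_parity[OF X, of "b 1" True] wo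
        by auto
      then show ?thesis using 2 by auto
    next
      case 3
      have "\<exists>i \<in> {1, 2}. (?O \<longrightarrow> odd (sum (a i) (I v))) \<and> (?N \<longrightarrow> odd (sum (b i) (I v)))"
      proof (rule two_color_parity_sum[OF X])
        fix x assume x: "x \<in> I v"
        \<comment> \<open>With the trivial predicate, the pullback count says that all copies have
          out-degrees of the same parity as \<open>v\<close>.\<close>
        show "odd (a 1 x + a 2 x) \<longleftrightarrow> odd (card {e \<in> arcs D. tail D e = v})"
          using out.odd_pullback_count[OF v x, of "\<lambda>_. True"] split[of "\<lambda>a. tail ED a = x"] 3
          by (simp add: a_def k2)
        show "odd (b 1 x + b 2 x) \<longleftrightarrow> odd (card {e \<in> arcs D. head D e = v})"
          using into.odd_pullback_count[OF v x, of "\<lambda>_. True"] split[of "\<lambda>a. head ED a = x"] 3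
          by (simp add: b_def k2)
        show "\<exists>i \<in> {1, 2}. (?O \<longrightarrow> odd (a i x)) \<and> (?N \<longrightarrow> odd (b i x))"
          using wo[OF x] ON unfolding 3 k2(1) by argo
      qed
      then show ?thesis using 3 k2 by simp
    qed
    then show ?thesis unfolding WO_at_iff using A B by blast
  qed
  then have "weak_odd_edge_coloring D k \<phi>'"
    using \<phi>'_range by (auto simp: weak_odd_edge_coloring_def)
  then show ?thesis by blast
qed

theorem theorem4p1:
  fixes D :: "('a, 'b) pre_digraph" and ED :: "('c, 'd) pre_digraph"
    and s :: "'a \<Rightarrow> nat" and I :: "'a \<Rightarrow> 'c set"
  assumes "digraph D"
    and "extended_digraph D s I ED"
    and "\<And>v. v \<in> verts D \<Longrightarrow> odd (s v)"
  shows "weak_odd_chromatic_index ED = weak_odd_chromatic_index D"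
proof -
  obtain \<pi> where
    out: "odd_blowup (arcs ED) (arcs D) \<pi> (tail ED) (head ED) (tail D) (head D) (verts D) I" and
    into: "odd_blowup (arcs ED) (arcs D) \<pi> (head ED) (tail ED) (head D) (tail D) (verts D) I"
    using assms by (rule extended_digraph_blowup)
  have verts: "verts ED = (\<Union>v \<in> verts D. I v)"
    using assms(2) by (simp add: extended_digraph_def)
  have "(\<exists>\<phi>. weak_odd_edge_coloring ED k \<phi>) \<longleftrightarrow> (\<exists>\<phi>. weak_odd_edge_coloring D k \<phi>)" for k
  proof
    assume ED: "\<exists>\<phi>. weak_odd_edge_coloring ED k \<phi>"
    show "\<exists>\<phi>. weak_odd_edge_coloring D k \<phi>"
    proof (cases "k \<le> 2")
      case True
      then show ?thesis using ED weak_odd_pushforward[OF out into verts] by blast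
    next
      case False
      \<comment> \<open>Three colors always suffice for \<open>D\<close>, whatever the coloring of
        \<open>ED\<close>.\<close>
      then show ?thesis
        using digraph.weak_odd_3_edge_colorable[OF assms(1)] weak_odd_edge_coloring_mono[of D 3 _ k]
        by fastforce
    qed
  qed (use weak_odd_pullback[OF out into verts] in blast)
  then show ?thesis by (simp add: weak_odd_chromatic_index_def)
qed

end
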